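(* Let $n\geq 2$, and fix $r>0$ and $\alpha>0$. Let $p$ be the solution (on $[r,\infty)$) of $$p'=-(1+p^2)\left(1+\frac{n-1}{\rho}\,p\right),\qquad p(r)=\alpha .$$ Then there exists $R>r$ such that, with $$U(\rho)=\int_r^\rho p(s)\,ds,\qquad b=U(r)=0,\qquad a=U(R)<0,$$ the function $u(x)=U(|x|)$ on the shell $A_{r,R}=B_R\setminus\overline{B_r}\subset\mathbb{R}^n$ is a radial solution of $$-\operatorname{div}\left(\frac{Du}{\sqrt{1+|Du|^2}}\right)=\frac{1}{\sqrt{1+|Du|^2}}\quad\text{in }A_{r,R}$$ with $u=a$ on $\partial B_R$ and $u=b$ on $\partial B_r$, and satisfies the boundary law $\partial_\nu u=\Gamma H+C$ on $\partial A_{r,R}$ for some constants $\Gamma>0$ and $C\in\mathbb{R}$. Nevertheless, $u>b$ in $A_{r,R}$ near the inner boundary $\partial B_r$, so the strict ordering $a<u<b$ in $A_{r,R}$ fails.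
   Context: $B_\rho$ is the open ball of radius $\rho$ centered at the origin of $\mathbb{R}^n$. $\nu$ is the outer unit normal of $A_{r,R}$ (pointing into $B_r$ on $\partial B_r$), and $H=-\frac{1}{n-1}\operatorname{div}_{\partial A_{r,R}}\nu$ is the normalized mean curvature; thus $H=-1/R$ on $\partial B_R$ and $H=1/r$ on $\partial B_r$. *)

theory Defs
  imports "HOL-Analysis.Analysis"
begin

definition shell :: "real \<Rightarrow> real \<Rightarrow> (real ^ 'n) set" where
  "shell r R = ball 0 R - cball 0 r"

definition solves_profile_ode :: "nat \<Rightarrow> real \<Rightarrow> real \<Rightarrow> (real \<Rightarrow> real) \<Rightarrow> bool" where
  "solves_profile_ode n r \<alpha> p \<longleftrightarrow>
     p r = \<alpha> \<and>
     (\<forall>\<rho>\<ge>r. (p has_real_derivative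
         - (1 + (p \<rho>)\<^sup>2) * (1 + (real n - 1) / \<rho> * p \<rho>)) (at \<rho> within {r..}))"

text \<open>
  \<^prop>\<open>C1_closure_C2 A u Du\<close> says that \<open>u\<close> is of class C2 in \<open>A\<close> and C1 up to the
  boundary, with gradient \<open>Du\<close>. At boundary points the derivative is taken from within the
  closure of \<open>A\<close>, so that values of \<open>u\<close> outside the closure play no role.
\<close>

definition C1_closure_C2 ::
  "(real ^ 'n) set \<Rightarrow> (real ^ 'n \<Rightarrow> real) \<Rightarrow> (real ^ 'n \<Rightarrow> real ^ 'n) \<Rightarrow> bool" where
  "C1_closure_C2 A u Du \<longleftrightarrow>
     (\<forall>x\<in>closure A. (u has_derivative (\<lambda>h. Du x \<bullet> h)) (at x within closure A)) \<and>
     continuous_on (closure A) Du \<and>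
     (\<exists>D2u :: real ^ 'n \<Rightarrow> real ^ 'n ^ 'n.
        (\<forall>x\<in>A. (Du has_derivative (\<lambda>h. D2u x *v h)) (at x)) \<and> continuous_on A D2u)"

definition has_divergence :: "(real ^ 'n \<Rightarrow> real ^ 'n) \<Rightarrow> real ^ 'n \<Rightarrow> real \<Rightarrow> bool" where
  "has_divergence X x d \<longleftrightarrow>
     (\<exists>X'. (X has_derivative X') (at x) \<and> d = (\<Sum>i\<in>UNIV. X' (axis i 1) $ i))"

text \<open>
  Outer unit normal of a set with C1 boundary, read off from a local defining function \<open>\<phi>\<close>
  that is negative exactly in \<open>A\<close>.
\<close>

definition is_outer_unit_normal :: "(real ^ 'n) set \<Rightarrow> (real ^ 'n \<Rightarrow> real ^ 'n) \<Rightarrow> bool" where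
  "is_outer_unit_normal A \<nu> \<longleftrightarrow>
     (\<forall>x\<in>frontier A. \<exists>V \<phi> D\<phi>.
        open V \<and> x \<in> V \<and>
        (\<forall>y\<in>V. GDERIV \<phi> y :> D\<phi> y) \<and> continuous_on V D\<phi> \<and> D\<phi> x \<noteq> 0 \<and>
        A \<inter> V = {y\<in>V. \<phi> y < 0} \<and> frontier A \<inter> V = {y\<in>V. \<phi> y = 0} \<and>
        \<nu> x = D\<phi> x /\<^sub>R norm (D\<phi> x))"

text \<open>
  Divergence along a hypersurface \<open>S\<close> with unit normal field \<open>\<nu>\<close>: the trace over the tangent
  space, i.e. the full trace minus its normal part. A derivative \<open>X'\<close> within \<open>S\<close> is determined
  only on tangent vectors, but the value \<open>d\<close> does not depend on its normal component
  \<open>X' (\<nu> x)\<close>.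
\<close>

definition has_surface_divergence ::
  "(real ^ 'n) set \<Rightarrow> (real ^ 'n \<Rightarrow> real ^ 'n) \<Rightarrow> (real ^ 'n \<Rightarrow> real ^ 'n) \<Rightarrow>
    real ^ 'n \<Rightarrow> real \<Rightarrow> bool" where
  "has_surface_divergence S \<nu> X x d \<longleftrightarrow>
     (\<exists>X'. (X has_derivative X') (at x within S) \<and>
        d = (\<Sum>i\<in>UNIV. X' (axis i 1) $ i) - X' (\<nu> x) \<bullet> \<nu> x)"

text \<open>
  With this sign convention the boundary of a ball of radius \<open>R\<close> has curvature \<open>- 1 / R\<close> with
  respect to its outer normal.
\<close>

definition is_mean_curvature ::
  "(real ^ 'n) set \<Rightarrow> (real ^ 'n \<Rightarrow> real ^ 'n) \<Rightarrow> (real ^ 'n \<Rightarrow> real) \<Rightarrow> bool" where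
  "is_mean_curvature A \<nu> H \<longleftrightarrow>
     (\<forall>x\<in>frontier A. \<exists>d. has_surface_divergence (frontier A) \<nu> \<nu> x d \<and>
        H x = - (1 / (real CARD('n) - 1)) * d)"

end

theory Submission
  imports Defs
begin

text \<open>
  Write \<open>c = n - 1\<close>. For a radial function \<open>u(x) = U(|x|)\<close> with \<open>U' = p\<close>, the normalized gradient is the
  radial field with factor \<open>p / (t * sqrt (1 + p^2))\<close> at distance \<open>t\<close> from the origin. Its divergence
  is \<open>(p' / (1 + p^2) + c * p / t) / sqrt (1 + p^2)\<close>, so the partial differential equation is exactly
  the profile equation (\<open>radial_solves_pde\<close>). Boundary values are automatic, and \<open>Du \<bullet> \<nu>\<close> and \<open>H\<close> are
  constant on each of the two spheres: \<open>- \<alpha>\<close> and \<open>1 / r\<close> on the inner one, \<open>p R\<close> and \<open>- 1 / R\<close> on the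
  outer one. A law \<open>Du \<bullet> \<nu> = \<Gamma> * H + C\<close> therefore always exists, and its slope \<open>\<Gamma>\<close> is positive if and
  only if \<open>p R < - \<alpha>\<close>.

  It remains to find \<open>R\<close> with \<open>p R < - \<alpha>\<close> and \<open>U R < 0\<close>. The curve \<open>t \<mapsto> - t / c\<close> is a lower barrier
  for the profile, which keeps the solution from blowing up (\<open>profile_exists\<close>), and above that curve
  the profile is nonincreasing. A profile bounded below would, far out, descend with slope at most
  \<open>- 1 / 2\<close>, which is absurd; so \<open>p\<close> eventually lies below any given level
  (\<open>profile_eventually_below\<close>), and then \<open>U\<close> becomes negative as well
  (\<open>height_eventually_negative\<close>). On the other hand \<open>p r = \<alpha> > 0\<close> makes \<open>U\<close> increase just outside the
  inner sphere, which is where the ordering \<open>u < b\<close> is violated.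
\<close>

section \<open>Scalar initial value problems on a half-line\<close>

lemma half_line_integral_has_derivative:
  fixes g :: "real \<Rightarrow> real"
  assumes "continuous_on {r..} g" "r \<le> t"
  shows "((\<lambda>t. integral {r..t} g) has_real_derivative g t) (at t within {r..})"
proof -
  have "((\<lambda>t. integral {r..t} g) has_real_derivative g t) (at t within {r..t+1})"
    by (rule integral_has_real_derivative)
      (use assms in \<open>auto intro: continuous_on_subset\<close>)
  moreover have "at t within {r..} = at t within {r..t+1}"
    by (rule at_within_nhd[where S="{..<t+1}"]) auto
  ultimately show ?thesis by simp
qed

lemma continuous_along_curve:
  fixes f :: "real \<Rightarrow> real \<Rightarrow> real"
  assumes "continuous_on ({r..} \<times> UNIV) (\<lambda>(t, x). f t x)" "continuous_on {r..} y"
  shows "continuous_on {r..} (\<lambda>t. f t (y t))"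
  using continuous_on_compose2[OF assms(1), of "{r..}" "\<lambda>t. (t, y t)"]
    continuous_on_Pair[OF continuous_on_id assms(2)]
  by auto

text \<open>
  The Picard iterates converge uniformly on every \<open>[r, T]\<close>: measured against the weight
  \<open>exp (2 * L * (t - r))\<close>, where \<open>L\<close> is a Lipschitz constant on \<open>[r, T]\<close>, each integration step
  halves the distance of successive iterates. As the iterates do not depend on \<open>T\<close>, their
  pointwise limit solves the problem on the whole half-line at once.
\<close>
lemma global_lipschitz_ivp_solution:
  fixes f :: "real \<Rightarrow> real \<Rightarrow> real"
  assumes cont: "continuous_on ({r..} \<times> UNIV) (\<lambda>(t, x). f t x)"
    and lip: "\<And>T. r \<le> T \<Longrightarrow> \<exists>L>0. \<forall>t\<in>{r..T}. \<forall>x y. \<bar>f t x - f t y\<bar> \<le> L * \<bar>x - y\<bar>"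
  obtains p where "p r = a"
    "\<And>t. r \<le> t \<Longrightarrow> (p has_real_derivative f t (p t)) (at t within {r..})"
proof -
  define P where "P = rec_nat (\<lambda>_. a) (\<lambda>_ q t. a + integral {r..t} (\<lambda>s. f s (q s)))"
  have P0: "P 0 t = a" for t by (simp add: P_def)
  have PS: "P (Suc k) t = a + integral {r..t} (\<lambda>s. f s (P k s))" for k t by (simp add: P_def)
  have contP: "continuous_on {r..} (P k)" for k
  proof (induction k)
    case 0
    then show ?case by (simp add: P_def)
  next
    case (Suc k)
    have "((\<lambda>t. integral {r..t} (\<lambda>s. f s (P k s))) has_real_derivative f t (P k t))
        (at t within {r..})" if "r \<le> t" for t
      using half_line_integral_has_derivative[OF continuous_along_curve[OF cont Suc] that] .
    then have "continuous_on {r..} (\<lambda>t. integral {r..t} (\<lambda>s. f s (P k s)))"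
      by (intro DERIV_continuous_on) auto
    then show ?case unfolding PS[abs_def] by (intro continuous_intros)
  qed
  have contfP: "continuous_on {r..t} (\<lambda>s. f s (P k s))" for k t
    using continuous_along_curve[OF cont contP[of k]] by (rule continuous_on_subset) auto
  define D where "D k t = P (Suc k) t - P k t" for k t
  define p where "p t = a + (\<Sum>k. D k t)" for t
  have unif: "uniform_limit {r..T} P p sequentially" if T: "r \<le> T" for T
  proof -
    obtain L where L: "L > 0" "\<And>t x y. t \<in> {r..T} \<Longrightarrow> \<bar>f t x - f t y\<bar> \<le> L * \<bar>x - y\<bar>"
      using lip[OF T] by blast
    have "continuous_on {r..T} (D 0)"
      unfolding D_def[abs_def]
      by (rule continuous_on_subset[of "{r..}"]) (auto intro!: continuous_intros contP)
    then have "bounded (D 0 ` {r..T})"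
      using compact_continuous_image compact_imp_bounded compact_Icc by blast
    then obtain B where B: "\<And>t. t \<in> {r..T} \<Longrightarrow> \<bar>D 0 t\<bar> \<le> B" "B > 0"
      unfolding bounded_pos by (metis image_eqI real_norm_def)
    have bound: "\<bar>D k t\<bar> \<le> B * (1/2)^k * exp (2 * L * (t - r))" if "t \<in> {r..T}" for k t
      using that
    proof (induction k arbitrary: t)
      case 0
      have "B * 1 \<le> B * exp (2 * L * (t - r))"
        using 0 L(1) B(2) by (intro mult_left_mono) auto
      then show ?case using B(1)[OF 0] by simp
    next
      case (Suc k)
      let ?g = "\<lambda>s. L * (B * (1/2)^k * exp (2 * L * (s - r)))"
      let ?G = "\<lambda>s. B * (1/2)^Suc k * exp (2 * L * (s - r))"
      have G: "(?g has_integral (?G t - ?G r)) {r..t}"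
        by (rule fundamental_theorem_of_calculus)
          (use Suc.prems in \<open>auto simp flip: has_real_derivative_iff_has_vector_derivative
            intro!: derivative_eq_intros\<close>)
      have "D (Suc k) t = integral {r..t} (\<lambda>s. f s (P (Suc k) s) - f s (P k s))"
        using PS[of "Suc k" t] PS[of k t] unfolding D_def
        by (subst integral_diff) (auto intro!: integrable_continuous_interval contfP)
      also have "norm \<dots> \<le> integral {r..t} ?g"
      proof (rule integral_norm_bound_integral)
        show "(\<lambda>s. f s (P (Suc k) s) - f s (P k s)) integrable_on {r..t}"
          by (intro integrable_diff integrable_continuous_interval contfP)
        show "?g integrable_on {r..t}" using G by blast
        fix s assume s: "s \<in> {r..t}"
        then have sT: "s \<in> {r..T}" using Suc.prems by auto
        have "\<bar>f s (P (Suc k) s) - f s (P k s)\<bar> \<le> L * \<bar>D k s\<bar>"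
          unfolding D_def by (rule L(2)[OF sT])
        also have "\<dots> \<le> ?g s" using Suc.IH[OF sT] L(1) by (intro mult_left_mono) auto
        finally show "norm (f s (P (Suc k) s) - f s (P k s)) \<le> ?g s" by simp
      qed
      also have "\<dots> = ?G t - ?G r" using G by (rule integral_unique)
      also have "\<dots> \<le> ?G t" using B(2) by simp
      finally show ?case by simp
    qed
    have "uniform_limit {r..T} (\<lambda>n t. \<Sum>k<n. D k t) (\<lambda>t. \<Sum>k. D k t) sequentially"
    proof (rule Weierstrass_m_test)
      show "summable (\<lambda>k. B * exp (2 * L * (T - r)) * (1/2)^k)"
        by (intro summable_mult summable_geometric) simp
      fix k t assume t: "t \<in> {r..T}"
      have "exp (2 * L * (t - r)) \<le> exp (2 * L * (T - r))" using t L(1) by simp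
      then have "B * (1/2)^k * exp (2 * L * (t - r)) \<le> B * (1/2)^k * exp (2 * L * (T - r))"
        using B(2) by (intro mult_left_mono) auto
      with bound[OF t, of k] show "norm (D k t) \<le> B * exp (2 * L * (T - r)) * (1/2)^k"
        by (simp add: mult_ac)
    qed
    then have "uniform_limit {r..T} (\<lambda>n t. a + (\<Sum>k<n. D k t)) p sequentially"
      unfolding p_def[abs_def] by (intro uniform_limit_add uniform_limit_const)
    moreover have "a + (\<Sum>k<n. D k t) = P n t" for n t
      unfolding D_def using sum_lessThan_telescope[of "\<lambda>k. P k t" n] by (simp add: P0)
    ultimately show ?thesis by simp
  qed
  have contp: "continuous_on {r..} p"
  proof -
    have "continuous (at t within {r..}) p" if t: "r \<le> t" for t
    proof -
      have "continuous_on {r..t+1} p"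
        using t by (intro uniform_limit_theorem[OF always_eventually unif])
          (auto intro: continuous_on_subset[OF contP])
      then have "continuous (at t within {r..t+1}) p"
        using t by (auto simp: continuous_on_eq_continuous_within)
      moreover have "at t within {r..} = at t within {r..t+1}"
        by (rule at_within_nhd[where S="{..<t+1}"]) auto
      ultimately show ?thesis by simp
    qed
    then show ?thesis by (auto simp: continuous_on_eq_continuous_within)
  qed
  have fixpoint: "p t = a + integral {r..t} (\<lambda>s. f s (p s))" if t: "r \<le> t" for t
  proof -
    obtain L where L: "L > 0" "\<And>s x y. s \<in> {r..t} \<Longrightarrow> \<bar>f s x - f s y\<bar> \<le> L * \<bar>x - y\<bar>"
      using lip[OF t] by blast
    have "uniform_limit {r..t} (\<lambda>k s. f s (P k s)) (\<lambda>s. f s (p s)) sequentially"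
    proof (rule uniform_limitI)
      fix e :: real assume "e > 0"
      then have "\<forall>\<^sub>F k in sequentially. \<forall>s\<in>{r..t}. dist (P k s) (p s) < e / L"
        using uniform_limitD[OF unif[OF t]] L(1) by simp
      then show "\<forall>\<^sub>F k in sequentially. \<forall>s\<in>{r..t}. dist (f s (P k s)) (f s (p s)) < e"
      proof eventually_elim
        case (elim k)
        show ?case
        proof
          fix s assume s: "s \<in> {r..t}"
          have "dist (f s (P k s)) (f s (p s)) \<le> L * dist (P k s) (p s)"
            using L(2)[OF s] by (simp add: dist_real_def)
          also have "\<dots> < e" using elim s L(1) by (auto simp: field_simps)
          finally show "dist (f s (P k s)) (f s (p s)) < e" .
        qed
      qed
    qed
    then obtain I J where IJ: "\<And>k. ((\<lambda>s. f s (P k s)) has_integral I k) {r..t}"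
      "((\<lambda>s. f s (p s)) has_integral J) {r..t}" "I \<longlonglongrightarrow> J"
      using uniform_limit_integral[where a=r and b=t and f="\<lambda>k s. f s (P k s)"] contfP sequentially_bot by metis
    have "(\<lambda>k. P (Suc k) t) \<longlonglongrightarrow> a + J"
      using tendsto_add[OF tendsto_const IJ(3)] by (simp add: PS integral_unique[OF IJ(1)])
    moreover have "(\<lambda>k. P k t) \<longlonglongrightarrow> p t"
      using tendsto_uniform_limitI[OF unif[OF t]] t by auto
    then have "(\<lambda>k. P (Suc k) t) \<longlonglongrightarrow> p t" by (rule LIMSEQ_Suc)
    ultimately show ?thesis using LIMSEQ_unique integral_unique[OF IJ(2)] by blast
  qed
  show ?thesis
  proof
    show "p r = a" using fixpoint[of r] by simp
    fix t assume t: "r \<le> t"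
    have "((\<lambda>t. a + integral {r..t} (\<lambda>s. f s (p s))) has_real_derivative f t (p t))
        (at t within {r..})"
      using DERIV_add[OF DERIV_const
        half_line_integral_has_derivative[OF continuous_along_curve[OF cont contp] t]] by simp
    then show "(p has_real_derivative f t (p t)) (at t within {r..})"
      by (rule has_field_derivative_transform_within[where d=1])
        (use t fixpoint in auto)
  qed
qed

text \<open>
  The integrating factor \<open>exp (- integral {r..t} G)\<close> turns \<open>d\<close> into a constant, which
  vanishes at \<open>r\<close>.
\<close>
lemma linear_ode_zero:
  fixes d G :: "real \<Rightarrow> real"
  assumes "continuous_on {r..} G" "d r = 0"
    and d: "\<And>t. r \<le> t \<Longrightarrow> (d has_real_derivative G t * d t) (at t within {r..})"
    and "r \<le> t"
  shows "d t = 0"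
proof -
  let ?h = "\<lambda>t. d t * exp (- integral {r..t} G)"
  have "(?h has_real_derivative 0) (at t within {r..})" if "t \<in> {r..}" for t
    using that
    by (auto intro!: derivative_eq_intros d half_line_integral_has_derivative[OF assms(1)])
  then obtain c where c: "\<And>t. t \<in> {r..} \<Longrightarrow> ?h t = c"
    using has_field_derivative_zero_constant[of "{r..}" ?h] by auto
  from c[of r] c[of t] assms show ?thesis by simp
qed

lemma slope_bound:
  fixes g g' :: "real \<Rightarrow> real"
  assumes "s \<le> t" "\<And>x. s \<le> x \<Longrightarrow> x \<le> t \<Longrightarrow> (g has_real_derivative g' x) (at x within {r..})"
    and "r \<le> s" "\<And>x. s < x \<Longrightarrow> x < t \<Longrightarrow> g' x \<le> k"
  shows "g t - g s \<le> k * (t - s)"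
proof (cases "s = t")
  case False
  then have "s < t" using assms by simp
  moreover have "(g has_derivative (*) (g' x)) (at x within {s..t})" if "s \<le> x" "x \<le> t" for x
    using assms(2)[OF that] \<open>r \<le> s\<close> unfolding has_field_derivative_def
    by (auto intro: has_derivative_subset)
  ultimately obtain x where "x \<in> {s<..<t}" "g t - g s = g' x * (t - s)"
    using mvt_simple[of s t g "\<lambda>x. (*) (g' x)"] by auto
  then show ?thesis using assms(4)[of x] \<open>s < t\<close> by (auto intro: mult_right_mono)
qed simp

text \<open>
  If \<open>y\<close> were positive at \<open>t\<close>, it would have increased since the last time before \<open>t\<close> at which it
  was not positive, although it cannot increase while it is positive.
\<close>
lemma barrier:
  fixes y y' :: "real \<Rightarrow> real"
  assumes d: "\<And>t. r \<le> t \<Longrightarrow> (y has_real_derivative y' t) (at t within {r..})"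
    and "y r \<le> 0" and neg: "\<And>t. r \<le> t \<Longrightarrow> 0 < y t \<Longrightarrow> y' t \<le> 0"
    and "r \<le> t"
  shows "y t \<le> 0"
proof (rule ccontr)
  assume "\<not> y t \<le> 0"
  define S where "S = {s \<in> {r..t}. y s \<le> 0}"
  have "continuous_on {r..} y" using d by (intro DERIV_continuous_on) auto
  then have "continuous_on {r..t} y" by (rule continuous_on_subset) auto
  then have "closed ({r..t} \<inter> y -` {..0})" by (rule continuous_closed_preimage) auto
  moreover have "{r..t} \<inter> y -` {..0} = S" by (auto simp: S_def)
  ultimately have "closed S" by simp
  moreover have "r \<in> S" "bdd_above S" using assms by (auto simp: S_def)
  ultimately have "Sup S \<in> S" using closed_contains_Sup by blast
  have pos: "y x > 0" if "Sup S < x" "x < t" for x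
  proof (rule ccontr)
    assume "\<not> y x > 0"
    then have "x \<in> S" using that \<open>Sup S \<in> S\<close> by (auto simp: S_def)
    then have "x \<le> Sup S" using \<open>bdd_above S\<close> cSup_upper by blast
    with that show False by simp
  qed
  have "y t - y (Sup S) \<le> 0 * (t - Sup S)"
    using \<open>Sup S \<in> S\<close> pos by (intro slope_bound[where r=r and g'=y'] d neg) (auto simp: S_def)
  with \<open>Sup S \<in> S\<close> \<open>\<not> y t \<le> 0\<close> show False by (simp add: S_def)
qed

section \<open>The profile\<close>

text \<open>The parameter \<open>c\<close> stands for \<open>n - 1\<close>.\<close>
definition profile_rhs :: "real \<Rightarrow> real \<Rightarrow> real \<Rightarrow> real" where
  "profile_rhs c t x = - (1 + x\<^sup>2) * (1 + c / t * x)"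

lemma profile_rhs_diff:
  "profile_rhs c t x - profile_rhs c t y =
    - (x + y + c / t * (1 + x\<^sup>2 + x * y + y\<^sup>2)) * (x - y)"
proof -
  have "- (1 + x\<^sup>2) * (1 + m * x) - - (1 + y\<^sup>2) * (1 + m * y) =
      - (x + y + m * (1 + x\<^sup>2 + x * y + y\<^sup>2)) * (x - y)" for m :: real
    by (simp add: algebra_simps power2_eq_square)
  then show ?thesis unfolding profile_rhs_def .
qed

lemma profile_rhs_lipschitz:
  assumes "\<bar>x\<bar> \<le> K" "\<bar>y\<bar> \<le> K" "0 < r" "r \<le> t" "0 \<le> c"
  shows "\<bar>profile_rhs c t x - profile_rhs c t y\<bar> \<le> (2 * K + c / r * (1 + 3 * K\<^sup>2)) * \<bar>x - y\<bar>"
proof -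
  have sq: "\<bar>x\<^sup>2\<bar> \<le> K\<^sup>2" "\<bar>y\<^sup>2\<bar> \<le> K\<^sup>2" "\<bar>x * y\<bar> \<le> K\<^sup>2"
    using mult_mono[OF assms(1,1)] mult_mono[OF assms(2,2)] mult_mono[OF assms(1,2)] assms(1,2)
    by (auto simp: abs_mult power2_eq_square)
  let ?Q = "c / t * (1 + x\<^sup>2 + x * y + y\<^sup>2)"
  have "\<bar>?Q\<bar> = c / t * \<bar>1 + x\<^sup>2 + x * y + y\<^sup>2\<bar>"
    using assms by (simp add: abs_mult)
  also have "\<dots> \<le> c / r * (1 + 3 * K\<^sup>2)"
  proof (intro mult_mono frac_le)
    show "\<bar>1 + x\<^sup>2 + x * y + y\<^sup>2\<bar> \<le> 1 + 3 * K\<^sup>2" using sq by linarith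
  qed (use assms in auto)
  finally have Q: "\<bar>?Q\<bar> \<le> c / r * (1 + 3 * K\<^sup>2)" .
  have "\<bar>- (x + y + q)\<bar> \<le> 2 * K + \<bar>q\<bar>" for q using assms(1,2) by linarith
  from order_trans[OF this add_left_mono[OF Q]]
  have "\<bar>- (x + y + ?Q)\<bar> \<le> 2 * K + c / r * (1 + 3 * K\<^sup>2)" .
  then show ?thesis
    unfolding profile_rhs_diff abs_mult by (intro mult_right_mono) auto
qed

lemma profile_rhs_nonpos:
  assumes "0 \<le> 1 + c / t * x"
  shows "profile_rhs c t x \<le> 0"
proof -
  have "0 \<le> (1 + x\<^sup>2) * (1 + c / t * x)"
    using assms by (intro mult_nonneg_nonneg) auto
  then show ?thesis
    unfolding profile_rhs_def mult_minus_left by (simp only: neg_le_0_iff_le)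
qed

text \<open>
  By \<open>profile_rhs_diff\<close>, the difference of two solutions solves a linear equation with a coefficient
  that is continuous, as both solutions are.
\<close>
lemma profile_unique:
  assumes "0 < r" "p r = q r"
    and p: "\<And>t. r \<le> t \<Longrightarrow> (p has_real_derivative profile_rhs c t (p t)) (at t within {r..})"
    and q: "\<And>t. r \<le> t \<Longrightarrow> (q has_real_derivative profile_rhs c t (q t)) (at t within {r..})"
    and "r \<le> t"
  shows "p t = q t"
proof -
  let ?G = "\<lambda>t. - (p t + q t + c / t * (1 + (p t)\<^sup>2 + p t * q t + (q t)\<^sup>2))"
  have "continuous_on {r..} p" "continuous_on {r..} q"
    using p q by (auto intro!: DERIV_continuous_on)
  then have "continuous_on {r..} ?G"
    using \<open>0 < r\<close> by (auto intro!: continuous_intros)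
  moreover have "((\<lambda>t. p t - q t) has_real_derivative ?G t * (p t - q t)) (at t within {r..})"
    if "r \<le> t" for t
    using DERIV_diff[OF p q, OF that that] unfolding profile_rhs_diff .
  ultimately have "p t - q t = 0"
    using assms linear_ode_zero[of r ?G "\<lambda>t. p t - q t" t] by simp
  then show ?thesis by simp
qed

text \<open>
  The cubic right-hand side is not globally Lipschitz, so \<open>x\<close> is first truncated to the band
  \<open>[- t / c, \<alpha>]\<close>: outside the band the slope becomes that at the nearest edge. The band is
  invariant, because on its upper edge the slope is negative, and on its lower edge, the zero set of \<open>1 + c / t * x\<close>, the slope is zero while the edge itself descends.
  Hence the solution of the truncated equation never leaves the band and solves the original one.
\<close>
lemma profile_exists:
  assumes "0 < r" "0 < \<alpha>" "0 < c"
  obtains p where "p r = \<alpha>"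
    "\<And>t. r \<le> t \<Longrightarrow> (p has_real_derivative profile_rhs c t (p t)) (at t within {r..})"
    "\<And>t. r \<le> t \<Longrightarrow> - (t / c) \<le> p t"
proof -
  define clamp where "clamp t x = max (- (t / c)) (min \<alpha> x)" for t x
  let ?F = "\<lambda>t x. profile_rhs c t (clamp t x)"
  have cont: "continuous_on ({r..} \<times> UNIV) (\<lambda>(t, x). ?F t x)"
    unfolding profile_rhs_def clamp_def case_prod_beta
    using assms by (auto intro!: continuous_intros)
  have lip: "\<exists>L>0. \<forall>t\<in>{r..T}. \<forall>x y. \<bar>?F t x - ?F t y\<bar> \<le> L * \<bar>x - y\<bar>" if "r \<le> T" for T
  proof (intro exI conjI ballI allI)
    let ?K = "max \<alpha> (T / c)"
    let ?L = "2 * ?K + c / r * (1 + 3 * ?K\<^sup>2)"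
    show "?L > 0" using assms by (intro add_pos_nonneg) auto
    fix t x y assume t: "t \<in> {r..T}"
    have K: "\<bar>clamp t x\<bar> \<le> ?K" for x
    proof -
      have "t / c \<le> T / c" "0 < t / c" using t assms by (auto intro: divide_right_mono)
      then show ?thesis using assms(2) unfolding clamp_def by linarith
    qed
    have "\<bar>?F t x - ?F t y\<bar> \<le> ?L * \<bar>clamp t x - clamp t y\<bar>"
      using K t assms by (intro profile_rhs_lipschitz) auto
    also have "\<dots> \<le> ?L * \<bar>x - y\<bar>"
    proof (rule mult_left_mono)
      show "\<bar>clamp t x - clamp t y\<bar> \<le> \<bar>x - y\<bar>" unfolding clamp_def by linarith
    qed (use \<open>?L > 0\<close> in simp)
    finally show "\<bar>?F t x - ?F t y\<bar> \<le> ?L * \<bar>x - y\<bar>" .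
  qed
  obtain p where p: "p r = \<alpha>"
    "\<And>t. r \<le> t \<Longrightarrow> (p has_real_derivative ?F t (p t)) (at t within {r..})"
    using global_lipschitz_ivp_solution[OF cont lip] by blast
  have upper: "p t \<le> \<alpha>" if "r \<le> t" for t
  proof -
    have "p t - \<alpha> \<le> 0"
    proof (rule barrier[where y="\<lambda>t. p t - \<alpha>" and y'="\<lambda>t. ?F t (p t)", OF _ _ _ that])
      show "((\<lambda>t. p t - \<alpha>) has_real_derivative ?F t (p t)) (at t within {r..})" if "r \<le> t" for t
        using that by (auto intro!: derivative_eq_intros p)
      fix t assume t: "r \<le> t" "0 < p t - \<alpha>"
      have "0 < t / c" using t assms by simp
      then have "clamp t (p t) = \<alpha>" using t(2) assms(2) unfolding clamp_def by linarith
      then show "?F t (p t) \<le> 0"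
        using t assms by (intro profile_rhs_nonpos) simp
    qed (use p in auto)
    then show ?thesis by simp
  qed
  have lower: "- (t / c) \<le> p t" if "r \<le> t" for t
  proof -
    have "- (t / c) - p t \<le> 0"
    proof (rule barrier[where y="\<lambda>t. - (t / c) - p t" and y'="\<lambda>t. - (1 / c) - ?F t (p t)",
          OF _ _ _ that])
      show "((\<lambda>t. - (t / c) - p t) has_real_derivative - (1 / c) - ?F t (p t)) (at t within {r..})"
        if "r \<le> t" for t
        using that assms(3) by (auto intro!: derivative_eq_intros p)
      have "0 < r / c" using assms by simp
      then show "- (r / c) - p r \<le> 0" using p(1) assms(2) by linarith
      fix t assume t: "r \<le> t" "0 < - (t / c) - p t"
      then have "clamp t (p t) = - (t / c)" unfolding clamp_def by linarith
      then show "- (1 / c) - ?F t (p t) \<le> 0"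
        using t assms by (simp add: profile_rhs_def)
    qed
    then show ?thesis by simp
  qed
  show ?thesis
  proof (rule that)
    show "p r = \<alpha>" by (rule p)
    fix t assume t: "r \<le> t"
    show "- (t / c) \<le> p t" by (rule lower[OF t])
    have "clamp t (p t) = p t" using lower[OF t] upper[OF t] by (simp add: clamp_def)
    with p(2)[OF t] show "(p has_real_derivative profile_rhs c t (p t)) (at t within {r..})"
      by simp
  qed
qed

text \<open>
  Above \<open>- t / c\<close> the profile is nonincreasing. It cannot stay above some \<open>- M\<close>: for \<open>t \<ge> 2 * c * M\<close>
  the factor \<open>1 + c / t * p\<close> would be at least \<open>1 / 2\<close>, which forces a descent with slope at most
  \<open>- 1 / 2\<close>.
\<close>
lemma profile_eventually_below:
  assumes "0 < r" "0 < c"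
    and p: "\<And>t. r \<le> t \<Longrightarrow> (p has_real_derivative profile_rhs c t (p t)) (at t within {r..})"
    and lower: "\<And>t. r \<le> t \<Longrightarrow> - (t / c) \<le> p t"
  obtains T where "r \<le> T" "\<And>t. T \<le> t \<Longrightarrow> p t < - M"
proof -
  have ge0: "0 \<le> 1 + c / t * p t" if "r \<le> t" for t
  proof -
    have "c / t * - (t / c) \<le> c / t * p t"
      using lower[OF that] that assms by (intro mult_left_mono) auto
    then show ?thesis using that assms by auto
  qed
  have mono: "p t \<le> p s" if "r \<le> s" "s \<le> t" for s t
  proof -
    have "profile_rhs c x (p x) \<le> 0" if "r \<le> x" for x
      by (rule profile_rhs_nonpos[OF ge0[OF that]])
    then have "p t - p s \<le> 0 * (t - s)"
      using that p by (intro slope_bound[where r=r and g'="\<lambda>x. profile_rhs c x (p x)"]) auto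
    then show ?thesis by simp
  qed
  have "\<exists>T\<ge>r. p T < - M"
  proof (rule ccontr)
    assume "\<not> (\<exists>T\<ge>r. p T < - M)"
    then have ge: "- M \<le> p t" if "r \<le> t" for t using that by force
    \<comment> \<open>Descending from \<open>p s\<close> with slope \<open>- 1 / 2\<close>, the profile is at most \<open>- M - 1\<close> at \<open>t\<close>.\<close>
    define s where "s = max r (2 * c * M)"
    define t where "t = s + 2 * (p s + M + 1)"
    have s: "r \<le> s" "2 * c * M \<le> s" by (auto simp: s_def)
    have st: "s \<le> t" using ge[OF s(1)] by (simp add: t_def)
    have "profile_rhs c x (p x) \<le> - (1 / 2)" if "s < x" for x
    proof -
      have x: "r \<le> x" "0 < x" "2 * c * M \<le> x" using that s assms by auto
      have "c / x * - M \<le> c / x * p x" using ge x assms by (intro mult_left_mono) auto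
      moreover have "- (1 / 2) \<le> c / x * - M" using x by (simp add: field_simps)
      ultimately have "1 / 2 \<le> 1 + c / x * p x" by linarith
      then have "1 * (1 / 2) \<le> (1 + (p x)\<^sup>2) * (1 + c / x * p x)" by (intro mult_mono) auto
      from le_imp_neg_le[OF this] show ?thesis
        unfolding profile_rhs_def mult_minus_left by (simp only: mult_1)
    qed
    then have "p t - p s \<le> - (1 / 2) * (t - s)"
      using st s p by (intro slope_bound[where r=r and g'="\<lambda>x. profile_rhs c x (p x)"]) auto
    then have "p t \<le> - M - 1" by (simp add: t_def field_simps)
    with ge[of t] st s show False by simp
  qed
  then show ?thesis using mono that by (meson le_less_trans)
qed

text \<open>
  From \<open>T\<close> on the height descends at least at unit rate, so it has passed zero after a further
  length of \<open>\<bar>U T\<bar> + 1\<close>, where \<open>U T\<close> is the height at \<open>T\<close>.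
\<close>
lemma height_eventually_negative:
  fixes p :: "real \<Rightarrow> real"
  assumes "continuous_on {r..} p" "r \<le> T" "\<And>t. T \<le> t \<Longrightarrow> p t \<le> - 1"
  obtains R where "T < R" "integral {r..R} p < 0"
proof -
  define U where "U t = integral {r..t} p" for t
  define R where "R = T + \<bar>U T\<bar> + 1"
  have "U R - U T \<le> - 1 * (R - T)"
    using assms by (intro slope_bound[where r=r and g'=p])
      (auto simp: U_def[abs_def] R_def intro!: half_line_integral_has_derivative)
  then have "U R < 0" by (auto simp: R_def)
  then show ?thesis using that[of R] by (auto simp: U_def R_def)
qed

section \<open>Radial vector fields\<close>

lemma radial_field_has_derivative:
  fixes x :: "real ^ 'n"
  assumes "x \<noteq> 0" "(k has_real_derivative k') (at (norm x))"
  shows "((\<lambda>y. k (norm y) *\<^sub>R y) has_derivative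
    (\<lambda>h. k (norm x) *\<^sub>R h + (k' * (h \<bullet> sgn x)) *\<^sub>R x)) (at x)"
proof -
  have "((\<lambda>y. k (norm y)) has_derivative (\<lambda>h. k' * (h \<bullet> sgn x))) (at x)"
    using has_derivative_compose[OF has_derivative_norm[OF assms(1)]
        assms(2)[unfolded has_field_derivative_def]] .
  then show ?thesis
    using has_derivative_scaleR[OF _ has_derivative_ident] by fastforce
qed

text \<open>The direction \<open>x\<close> is an eigenvector of the rank-one part, with eigenvalue \<open>k' * norm x\<close>.\<close>
lemma radial_field_has_divergence:
  fixes x :: "real ^ 'n"
  assumes "x \<noteq> 0" "(k has_real_derivative k') (at (norm x))"
  shows "has_divergence (\<lambda>y. k (norm y) *\<^sub>R y) x (real CARD('n) * k (norm x) + k' * norm x)"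
proof -
  have "x \<bullet> x = norm x * norm x" by (simp add: dot_square_norm power2_eq_square)
  then have "(\<Sum>i\<in>UNIV. x $ i * x $ i) = norm x * norm x" by (simp add: inner_vec_def)
  then have "(\<Sum>i\<in>UNIV. k' * x $ i * x $ i / norm x) = k' * norm x"
    using assms(1) by (simp add: sum_distrib_left[symmetric] sum_divide_distrib[symmetric] mult.assoc)
  then have "real CARD('n) * k (norm x) + k' * norm x =
      (\<Sum>i\<in>UNIV. (k (norm x) *\<^sub>R axis i 1 + (k' * (axis i 1 \<bullet> sgn x)) *\<^sub>R x) $ i)"
    by (simp add: sum.distrib inner_axis' sgn_div_norm field_simps)
  with radial_field_has_derivative[OF assms] show ?thesis
    unfolding has_divergence_def by blast
qed

section \<open>The geometry of the shell\<close>

lemma open_shell: "open (shell r R :: (real ^ 'n) set)"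
  unfolding shell_def by (intro open_Diff) auto

lemma shell_iff: "x \<in> shell r R \<longleftrightarrow> r < norm x \<and> norm x < R"
  by (auto simp: shell_def)

lemma closure_shell_subset: "closure (shell r R :: (real ^ 'n) set) \<subseteq> {x. r \<le> norm x \<and> norm x \<le> R}"
proof (rule closure_minimal)
  show "closed {x :: real ^ 'n. r \<le> norm x \<and> norm x \<le> R}"
    by (intro closed_Collect_conj closed_Collect_le continuous_intros)
qed (auto simp: shell_iff)

lemma frontier_shell:
  assumes "0 < r" "r < R"
  shows "frontier (shell r R) = (sphere 0 r \<union> sphere 0 R :: (real ^ 'n) set)"
proof
  show "frontier (shell r R) \<subseteq> (sphere 0 r \<union> sphere 0 R :: (real ^ 'n) set)"
    using closure_shell_subset[of r R, where 'n='n] interior_open[OF open_shell[of r R, where 'n='n]]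
    by (auto simp: frontier_def shell_iff)
  show "(sphere 0 r \<union> sphere 0 R :: (real ^ 'n) set) \<subseteq> frontier (shell r R)"
  proof
    fix x :: "real ^ 'n" assume x: "x \<in> sphere 0 r \<union> sphere 0 R"
    have "x \<in> closure (shell r R)"
      unfolding closure_approachable
    proof (intro allI impI)
      fix e :: real assume "e > 0"
      define c where "c = (if norm x = r then r + min (e/2) ((R - r)/2) else R - min (e/2) ((R - r)/2))"
      have c: "r < c" "c < R" "\<bar>c - norm x\<bar> < e"
        using x assms \<open>e > 0\<close> by (auto simp: c_def min_def field_simps)
      have "norm x > 0" using x assms by auto
      have "(c / norm x) *\<^sub>R x - x = ((c - norm x) / norm x) *\<^sub>R x"
        using \<open>norm x > 0\<close> by (simp add: diff_divide_distrib scaleR_left_diff_distrib)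
      then have "dist ((c / norm x) *\<^sub>R x) x = \<bar>c - norm x\<bar>"
        using \<open>norm x > 0\<close> by (simp add: dist_norm)
      moreover have "(c / norm x) *\<^sub>R x \<in> shell r R"
        using c assms \<open>norm x > 0\<close> by (simp add: shell_iff)
      ultimately show "\<exists>y\<in>shell r R. dist y x < e" using c by force
    qed
    moreover have "x \<notin> shell r R" using x by (auto simp: shell_iff)
    ultimately show "x \<in> frontier (shell r R)"
      by (simp add: frontier_def interior_open[OF open_shell])
  qed
qed

definition shell_normal :: "real \<Rightarrow> real \<Rightarrow> real ^ 'n \<Rightarrow> real ^ 'n" where
  "shell_normal r R x = (if norm x = R then x /\<^sub>R R else - (x /\<^sub>R r))"

definition shell_curvature :: "real \<Rightarrow> real \<Rightarrow> real ^ 'n \<Rightarrow> real" where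
  "shell_curvature r R x = (if norm x = R then - 1 / R else 1 / r)"

text \<open>
  Up to sign and shift, the norm is the defining function. Near the outer sphere it is used off the ball
  enclosed by the shell, near the inner sphere off the origin, where it is not differentiable.
\<close>
lemma shell_outer_unit_normal:
  assumes "0 < r" "r < R"
  shows "is_outer_unit_normal (shell r R) (shell_normal r R :: real ^ 'n \<Rightarrow> real ^ 'n)"
  unfolding is_outer_unit_normal_def
proof
  fix x :: "real ^ 'n" assume "x \<in> frontier (shell r R)"
  then consider "norm x = R" | "norm x = r" by (auto simp: frontier_shell[OF assms])
  then show "\<exists>V \<phi> D\<phi>. open V \<and> x \<in> V \<and> (\<forall>y\<in>V. GDERIV \<phi> y :> D\<phi> y) \<and>
      continuous_on V D\<phi> \<and> D\<phi> x \<noteq> 0 \<and> shell r R \<inter> V = {y \<in> V. \<phi> y < 0} \<and>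
      frontier (shell r R) \<inter> V = {y \<in> V. \<phi> y = 0} \<and>
      shell_normal r R x = D\<phi> x /\<^sub>R norm (D\<phi> x)"
  proof cases
    case 1
    show ?thesis
    proof (intro exI[of _ "- cball 0 r"] exI[of _ "\<lambda>y. norm y - R"] exI[of _ sgn] conjI ballI)
      show "GDERIV (\<lambda>y. norm y - R) y :> sgn y" if "y \<in> - cball 0 r" for y :: "real ^ 'n"
      proof -
        have "y \<noteq> 0" using that assms by auto
        then show ?thesis using GDERIV_diff[OF GDERIV_norm GDERIV_const, of y R] by simp
      qed
      show "continuous_on (- cball 0 r) (sgn :: real ^ 'n \<Rightarrow> _)"
        using assms by (intro continuous_on_sgn continuous_on_id) auto
      show "shell_normal r R x = sgn x /\<^sub>R norm (sgn x)"
        using 1 assms by (simp add: shell_normal_def sgn_div_norm)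
    qed (use 1 assms in \<open>auto simp: frontier_shell[OF assms] shell_iff sgn_zero_iff\<close>)
  next
    case 2
    show ?thesis
    proof (intro exI[of _ "ball 0 R - {0}"] exI[of _ "\<lambda>y. r - norm y"] exI[of _ "\<lambda>y. - sgn y"]
        conjI ballI)
      show "GDERIV (\<lambda>y. r - norm y) y :> - sgn y" if "y \<in> ball 0 R - {0}" for y :: "real ^ 'n"
        using GDERIV_diff[OF GDERIV_const GDERIV_norm, of y r] that assms by auto
      show "continuous_on (ball 0 R - {0}) (\<lambda>y :: real ^ 'n. - sgn y)"
        using assms by (intro continuous_on_minus continuous_on_sgn continuous_on_id) auto
      show "shell_normal r R x = - sgn x /\<^sub>R norm (- sgn x)"
        using 2 assms by (auto simp: shell_normal_def sgn_div_norm)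
    qed (use 2 assms in \<open>auto simp: frontier_shell[OF assms] shell_iff sgn_zero_iff\<close>)
  qed
qed

text \<open>
  Near a point of one of the two spheres, the normal is the restriction of a linear map \<open>m *\<^sub>R id\<close>
  with \<open>m = 1 / R\<close> or \<open>m = - 1 / r\<close>, whose tangential trace is \<open>(n - 1) * m\<close>.
\<close>
lemma shell_mean_curvature:
  assumes "0 < r" "r < R" "CARD('n) \<ge> 2"
  shows "is_mean_curvature (shell r R) (shell_normal r R)
    (shell_curvature r R :: real ^ 'n::finite \<Rightarrow> real)"
  unfolding is_mean_curvature_def
proof
  let ?S = "frontier (shell r R) :: (real ^ 'n) set"
  have law: "\<exists>d. has_surface_divergence ?S (shell_normal r R) (shell_normal r R) x d \<and>
      shell_curvature r R x = - (1 / (real CARD('n) - 1)) * d"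
    if "x \<in> ?S" "m * norm x = 1 \<or> m * norm x = - 1" "shell_curvature r R x = - m"
      and eq: "\<And>y. y \<in> ?S \<Longrightarrow> dist y x < R - r \<Longrightarrow> shell_normal r R y = m *\<^sub>R y"
    for x :: "real ^ 'n" and m
  proof (intro exI conjI)
    have m: "shell_normal r R x = m *\<^sub>R x" using eq[OF \<open>x \<in> ?S\<close>] assms by simp
    have "(m * norm x)\<^sup>2 = 1" using that(2) by auto
    then have 1: "m * m * (x \<bullet> x) = 1"
      by (simp add: dot_square_norm power2_eq_square mult_ac)
    have "((\<lambda>y. m *\<^sub>R y) has_derivative (\<lambda>h. m *\<^sub>R h)) (at x within ?S)"
      by (auto intro!: derivative_eq_intros)
    then have "(shell_normal r R has_derivative (\<lambda>h. m *\<^sub>R h)) (at x within ?S)"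
      by (rule has_derivative_transform_within[where d="R - r"]) (use that assms eq in auto)
    moreover have "(real CARD('n) - 1) * m = (\<Sum>i\<in>UNIV. (m *\<^sub>R axis i 1 :: real ^ 'n) $ i) -
        (m *\<^sub>R shell_normal r R x) \<bullet> shell_normal r R x"
      using 1 by (simp add: m algebra_simps)
    ultimately show "has_surface_divergence ?S (shell_normal r R) (shell_normal r R) x
        ((real CARD('n) - 1) * m)"
      unfolding has_surface_divergence_def by blast
    show "shell_curvature r R x = - (1 / (real CARD('n) - 1)) * ((real CARD('n) - 1) * m)"
      using that(3) assms(3) by simp
  qed
  have tri: "\<bar>norm y - norm x\<bar> \<le> dist y x" for x y :: "real ^ 'n"
    using norm_triangle_ineq3 by (simp add: dist_norm)
  fix x :: "real ^ 'n" assume x: "x \<in> ?S"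
  then consider "norm x = R" | "norm x = r" by (auto simp: frontier_shell[OF assms(1,2)])
  then show "\<exists>d. has_surface_divergence ?S (shell_normal r R) (shell_normal r R) x d \<and>
      shell_curvature r R x = - (1 / (real CARD('n) - 1)) * d"
  proof cases
    case 1
    have "norm y = R" if "y \<in> ?S" "dist y x < R - r" for y
      using tri[of y x] that 1 by (auto simp: frontier_shell[OF assms(1,2)])
    then show ?thesis using 1 assms x
      by (intro law[where m="1 / R"]) (auto simp: shell_normal_def shell_curvature_def divide_inverse)
  next
    case 2
    have "norm y = r" if "y \<in> ?S" "dist y x < R - r" for y
      using tri[of y x] that 2 by (auto simp: frontier_shell[OF assms(1,2)])
    then show ?thesis using 2 assms x
      by (intro law[where m="- 1 / r"]) (auto simp: shell_normal_def shell_curvature_def divide_inverse)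
  qed
qed

section \<open>The radial solution\<close>

text \<open>
  On the inner sphere only the one-sided derivative of the height is available. It suffices for the
  derivative within the closure of the shell, since the norm maps the closure into \<open>{r..}\<close>.
\<close>
lemma radial_C1_closure_C2:
  fixes p p' :: "real \<Rightarrow> real"
  assumes "0 < r"
    and p: "\<And>t. r \<le> t \<Longrightarrow> (p has_real_derivative p' t) (at t within {r..})"
    and p': "continuous_on {r..} p'"
  shows "C1_closure_C2 (shell r R :: (real ^ 'n) set) (\<lambda>x. integral {r..norm x} p)
    (\<lambda>x. (p (norm x) / norm x) *\<^sub>R x)"
proof -
  let ?A = "shell r R :: (real ^ 'n) set"
  let ?k = "\<lambda>t. p t / t" and ?k' = "\<lambda>t. (p' t * t - p t) / (t * t)"
  let ?L = "\<lambda>x h :: real ^ 'n. ?k (norm x) *\<^sub>R h + (?k' (norm x) * (h \<bullet> sgn x)) *\<^sub>R x"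
  have contp: "continuous_on {r..} p" using p by (auto intro!: DERIV_continuous_on)
  have cl: "r \<le> norm x" "x \<noteq> 0" if "x \<in> closure ?A" for x
    using closure_shell_subset[of r R, where 'n='n] that assms(1) by auto
  have norm_A: "norm ` S \<subseteq> {r..}" if "S \<subseteq> closure ?A" for S using cl that by auto
  have sub: "?A \<subseteq> closure ?A" by (rule closure_subset)
  have 1: "((\<lambda>x. integral {r..norm x} p) has_derivative (\<lambda>h. ((p (norm x) / norm x) *\<^sub>R x) \<bullet> h))
      (at x within closure ?A)" if x: "x \<in> closure ?A" for x
  proof -
    have "((\<lambda>x. integral {r..norm x} p) has_derivative (\<lambda>h. p (norm x) * (h \<bullet> sgn x)))
        (at x within closure ?A)"
    proof (rule has_derivative_in_compose2[where t="{r..}" and g'="\<lambda>t. (*) (p t)"])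
      show "((\<lambda>t. integral {r..t} p) has_derivative (*) (p t)) (at t within {r..})"
        if "t \<in> {r..}" for t
        using half_line_integral_has_derivative[OF contp] that
        by (simp add: has_field_derivative_def)
      show "(norm has_derivative (\<lambda>h. h \<bullet> sgn x)) (at x within closure ?A)"
        using has_derivative_norm[OF cl(2)[OF x]] by (rule has_derivative_at_withinI)
    qed (use x norm_A in auto)
    then show ?thesis by (simp add: sgn_div_norm inner_commute field_simps)
  qed
  have 2: "continuous_on (closure ?A) (\<lambda>x. (p (norm x) / norm x) *\<^sub>R x)"
    using cl by (auto intro!: continuous_intros continuous_on_compose2[OF contp])
  have 3: "((\<lambda>x. (p (norm x) / norm x) *\<^sub>R x) has_derivative ?L x) (at x)" if "x \<in> ?A" for x
  proof (rule radial_field_has_derivative)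
    show "x \<noteq> 0" using that cl sub by blast
    have "at (norm x) within {r..} = at (norm x)"
      using that by (intro at_within_interior) (auto simp: shell_iff)
    then have "(p has_real_derivative p' (norm x)) (at (norm x))"
      using p[of "norm x"] that by (auto simp: shell_iff)
    then show "(?k has_real_derivative ?k' (norm x)) (at (norm x))"
      using \<open>x \<noteq> 0\<close> by (auto intro!: derivative_eq_intros)
  qed
  have 4: "(*v) (matrix (?L x)) = ?L x" if "x \<in> ?A" for x
    using has_derivative_bounded_linear[OF 3[OF that]] by (rule matrix_vector_mul)
  have 5: "continuous_on ?A (\<lambda>x. matrix (?L x))"
    unfolding matrix_def
    using cl sub by (intro continuous_on_vec_lambda)
      (auto intro!: continuous_intros continuous_on_compose2[OF contp] continuous_on_compose2[OF p']
        continuous_on_sgn)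
  show ?thesis
    unfolding C1_closure_C2_def
  proof (intro conjI ballI exI[of _ "\<lambda>x. matrix (?L x)"])
    fix x assume x: "x \<in> ?A"
    show "((\<lambda>x. (p (norm x) / norm x) *\<^sub>R x) has_derivative (*v) (matrix (?L x))) (at x)"
      unfolding 4[OF x] by (rule 3[OF x])
  qed (rule 1 2 5; assumption?)+
qed

text \<open>
  With \<open>s = sqrt (1 + p^2)\<close>, the normalized gradient is the radial field with factor \<open>p / (t * s)\<close>,
  whose divergence is \<open>p' / s^3 + (n - 1) * p / (t * s)\<close>. The profile equation is what makes this
  equal to \<open>- 1 / s\<close>.
\<close>
lemma radial_solves_pde:
  fixes x :: "real ^ 'n"
  assumes "x \<noteq> 0"
    and p: "(p has_real_derivative profile_rhs (real CARD('n) - 1) (norm x) (p (norm x))) (at (norm x))"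
  defines "Du \<equiv> \<lambda>y :: real ^ 'n. (p (norm y) / norm y) *\<^sub>R y"
  shows "has_divergence (\<lambda>y. Du y /\<^sub>R sqrt (1 + (norm (Du y))\<^sup>2)) x
    (- (1 / sqrt (1 + (norm (Du x))\<^sup>2)))"
proof -
  let ?s = "\<lambda>t. sqrt (1 + (p t)\<^sup>2)"
  let ?k = "\<lambda>t. p t / (t * ?s t)"
  let ?n = "real CARD('n)"
  have pos: "0 < 1 + (p t)\<^sup>2" for t by (simp add: add_pos_nonneg)
  have norm_Du: "sqrt (1 + (norm (Du y))\<^sup>2) = ?s (norm y)" if "y \<noteq> 0" for y
    using that by (simp add: Du_def)
  have field: "(\<lambda>y. Du y /\<^sub>R sqrt (1 + (norm (Du y))\<^sup>2)) = (\<lambda>y. ?k (norm y) *\<^sub>R y)"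
  proof
    show "Du y /\<^sub>R sqrt (1 + (norm (Du y))\<^sup>2) = ?k (norm y) *\<^sub>R y" for y
    proof (cases "y = 0")
      case False
      then show ?thesis by (subst norm_Du) (simp_all add: Du_def divide_inverse mult_ac)
    qed (simp add: Du_def)
  qed
  define t P S where "t = norm x" and "P = p t" and "S = ?s t"
  have t: "t > 0" and S: "S > 0" "S * S = 1 + P\<^sup>2"
    using assms(1) pos[of t] by (simp_all add: t_def S_def P_def)
  define D where "D = profile_rhs (?n - 1) t P"
  let ?k' = "D / (t * S ^ 3) - P / (t * t * S)"
  have p': "(p has_real_derivative D) (at t)" using p by (simp add: D_def P_def t_def)
  have "(sqrt has_real_derivative inverse S / 2) (at (1 + (p t)\<^sup>2))"
    using DERIV_real_sqrt[OF pos[of t]] by (simp only: S_def)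
  moreover have "((\<lambda>t. 1 + (p t)\<^sup>2) has_real_derivative 2 * P * D) (at t)"
    using DERIV_add[OF DERIV_const DERIV_power[OF p', of 2], of 1] by (simp add: P_def mult_ac)
  ultimately have "(?s has_real_derivative inverse S / 2 * (2 * P * D)) (at t)"
    by (rule DERIV_chain2)
  moreover have "inverse S / 2 * (2 * P * D) = P * D / S" by (simp add: field_simps)
  ultimately have s': "(?s has_real_derivative P * D / S) (at t)" by (simp only:)
  have "((\<lambda>t. t * ?s t) has_real_derivative S + P * D / S * t) (at t)"
    using DERIV_mult[OF DERIV_ident s'] by (simp add: S_def P_def)
  from DERIV_divide[OF p' this]
  have "(?k has_real_derivative (D * (t * S) - P * (S + P * D / S * t)) / ((t * S) * (t * S))) (at t)"
    using t S(1) by (simp add: S_def P_def)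
  moreover have "(D * (t * S) - P * (S + P * D / S * t)) / ((t * S) * (t * S)) = ?k'"
  proof -
    have "D * (t * S) - P * (S + P * D / S * t) = D * t * (S * S - P\<^sup>2) / S - P * S"
      using S(1) by (simp add: field_simps power2_eq_square)
    also have "\<dots> = D * t / S - P * S" using S(2) by simp
    finally show ?thesis
      using t S(1) by (simp add: diff_divide_distrib power3_eq_cube mult_ac)
  qed
  ultimately have "(?k has_real_derivative ?k') (at (norm x))" by (simp add: t_def)
  from radial_field_has_divergence[OF assms(1) this]
  have "has_divergence (\<lambda>y. ?k (norm y) *\<^sub>R y) x (?n * ?k t + ?k' * t)" by (simp add: t_def)
  moreover have "?n * ?k t + ?k' * t = - (1 / S)"
  proof -
    define q W where "q = P / t" and "W = 1 + (?n - 1) * q"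
    have "D = - (S * S) * W" by (simp add: D_def profile_rhs_def S(2) W_def q_def)
    then have "D / S ^ 3 = - W / S" using S(1) by (simp add: power3_eq_cube)
    moreover have "?k' * t = D / S ^ 3 - q / S"
      using t S(1) by (simp add: left_diff_distrib q_def)
    moreover have "?k t = q / S" by (simp add: P_def S_def q_def)
    ultimately have "?n * ?k t + ?k' * t = (?n * q - W - q) / S"
      by (simp add: diff_divide_distrib)
    then show ?thesis by (simp add: W_def algebra_simps)
  qed
  ultimately show ?thesis
    unfolding field norm_Du[OF assms(1)] by (simp add: S_def t_def)
qed

theorem proposition5p2:
  fixes r \<alpha> :: real
  assumes "CARD('n::finite) \<ge> 2" and "r > 0" and "\<alpha> > 0"
  shows "\<exists>p. solves_profile_ode CARD('n) r \<alpha> p \<and>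
    (\<forall>q. solves_profile_ode CARD('n) r \<alpha> q \<longrightarrow> (\<forall>\<rho>\<ge>r. q \<rho> = p \<rho>)) \<and>
    (\<exists>R>r.
      let U = (\<lambda>\<rho>. integral {r..\<rho>} p);
          u = (\<lambda>x :: real ^ 'n. U (norm x));
          A = (shell r R :: (real ^ 'n) set);
          b = U r;
          a = U R
      in
        b = 0 \<and> a < 0 \<and>
        (\<exists>Du \<nu> H.
          C1_closure_C2 A u Du \<and>
          (\<forall>x\<in>A. \<exists>d. has_divergence (\<lambda>y. Du y /\<^sub>R sqrt (1 + (norm (Du y))\<^sup>2)) x d \<and>
             - d = 1 / sqrt (1 + (norm (Du x))\<^sup>2)) \<and>
          (\<forall>x\<in>sphere 0 R. u x = a) \<and>
          (\<forall>x\<in>sphere 0 r. u x = b) \<and>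
          is_outer_unit_normal A \<nu> \<and>
          is_mean_curvature A \<nu> H \<and>
          (\<exists>\<Gamma>>0. \<exists>C. \<forall>x\<in>frontier A. Du x \<bullet> \<nu> x = \<Gamma> * H x + C)) \<and>
        (\<exists>\<delta>>0. \<forall>x\<in>A. norm x < r + \<delta> \<longrightarrow> u x > b) \<and>
        \<not> (\<forall>x\<in>A. a < u x \<and> u x < b))"
proof -
  define c where "c = real CARD('n) - 1"
  have c: "0 < c" using assms(1) by (simp add: c_def)
  have ode_iff: "solves_profile_ode CARD('n) r \<alpha> q \<longleftrightarrow> q r = \<alpha> \<and>
      (\<forall>t\<ge>r. (q has_real_derivative profile_rhs c t (q t)) (at t within {r..}))" for q
    unfolding solves_profile_ode_def profile_rhs_def c_def ..
  obtain p where p: "p r = \<alpha>"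
    "\<And>t. r \<le> t \<Longrightarrow> (p has_real_derivative profile_rhs c t (p t)) (at t within {r..})"
    "\<And>t. r \<le> t \<Longrightarrow> - (t / c) \<le> p t"
    using profile_exists[OF assms(2,3) c] by blast
  have contp: "continuous_on {r..} p" using p(2) by (auto intro!: DERIV_continuous_on)
  have contp': "continuous_on {r..} (\<lambda>t. profile_rhs c t (p t))"
    unfolding profile_rhs_def using assms(2) by (auto intro!: continuous_intros contp)
  have unique: "q t = p t" if "solves_profile_ode CARD('n) r \<alpha> q" "r \<le> t" for q t
  proof (rule profile_unique[OF assms(2) _ _ p(2) that(2)])
    show "q r = p r" using that(1) p(1) by (simp add: ode_iff)
    show "(q has_real_derivative profile_rhs c s (q s)) (at s within {r..})" if "r \<le> s" for s
      using \<open>solves_profile_ode CARD('n) r \<alpha> q\<close> that unfolding ode_iff by blast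
  qed
  obtain T where T: "r \<le> T" "\<And>t. T \<le> t \<Longrightarrow> p t < - (\<alpha> + 1)"
    using profile_eventually_below[OF assms(2) c p(2,3)] by blast
  have "p t \<le> - 1" if "T \<le> t" for t using T(2)[OF that] assms(3) by simp
  then obtain R where "T < R" and neg: "integral {r..R} p < 0"
    using height_eventually_negative[OF contp T(1)] by blast
  then have R: "r < R" "p R < - \<alpha>" using T(1) T(2)[of R] assms(3) by auto
  define U where "U t = integral {r..t} p" for t
  define u where "u = (\<lambda>x :: real ^ 'n. U (norm x))"
  define A where "A = (shell r R :: (real ^ 'n) set)"
  define Du where "Du = (\<lambda>x :: real ^ 'n. (p (norm x) / norm x) *\<^sub>R x)"
  define \<nu> where "\<nu> = (shell_normal r R :: real ^ 'n \<Rightarrow> real ^ 'n)"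
  define H where "H = (shell_curvature r R :: real ^ 'n \<Rightarrow> real)"
  have Ur: "U r = 0" by (simp add: U_def)

  have regular: "C1_closure_C2 A u Du"
    unfolding A_def u_def U_def Du_def by (rule radial_C1_closure_C2[OF assms(2) p(2) contp'])
  have pde: "has_divergence (\<lambda>y. Du y /\<^sub>R sqrt (1 + (norm (Du y))\<^sup>2)) x
      (- (1 / sqrt (1 + (norm (Du x))\<^sup>2)))" if "x \<in> A" for x
    unfolding Du_def
  proof (rule radial_solves_pde)
    have x: "r < norm x" using that by (simp add: A_def shell_iff)
    then show "x \<noteq> 0" using assms(2) by auto
    have "at (norm x) within {r..} = at (norm x)"
      using x by (intro at_within_interior) auto
    then show "(p has_real_derivative profile_rhs (real CARD('n) - 1) (norm x) (p (norm x)))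
        (at (norm x))"
      using p(2)[of "norm x"] x by (simp add: c_def)
  qed

  (* The law prescribes p R = - \<Gamma> / R + C on the outer and - \<alpha> = \<Gamma> / r + C on the inner sphere,
    which determines \<Gamma> and C; the sign of \<Gamma> is that of - p R - \<alpha>. *)
  define \<Gamma> where "\<Gamma> = (- p R - \<alpha>) / (1 / r + 1 / R)"
  define C where "C = - \<alpha> - \<Gamma> / r"
  have rR: "0 < 1 / r + 1 / R" using assms(2) R(1) by (simp add: add_pos_pos)
  then have "\<Gamma> > 0" using R(2) by (simp add: \<Gamma>_def)
  have "\<Gamma> * (1 / r + 1 / R) = - p R - \<alpha>" using rR by (simp add: \<Gamma>_def)
  then have outer: "p R = \<Gamma> * (- 1 / R) + C" by (simp add: C_def algebra_simps)
  have law: "Du x \<bullet> \<nu> x = \<Gamma> * H x + C" if "x \<in> frontier A" for x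
  proof -
    have "x \<bullet> x = norm x * norm x" by (simp add: dot_square_norm power2_eq_square)
    moreover have "norm x = R \<or> norm x = r"
      using that by (auto simp: A_def frontier_shell[OF assms(2) R(1)])
    ultimately show ?thesis
      using outer p(1) R(1) assms(2)
      by (auto simp: Du_def \<nu>_def H_def shell_normal_def shell_curvature_def C_def)
  qed

  have "continuous (at r within {r..}) p"
    using contp by (simp add: continuous_on_eq_continuous_within)
  then obtain \<delta> where \<delta>: "\<delta> > 0" "\<And>t. t \<in> {r..} \<Longrightarrow> dist t r < \<delta> \<Longrightarrow> dist (p t) (p r) < \<alpha>"
    using assms(3) unfolding continuous_within_eps_delta by blast
  have pos: "U t > 0" if t: "r < t" "t < r + \<delta>" for t
  proof -
    have "p s > 0" if "s \<in> {r..t}" for s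
      using \<delta>(2)[of s] that t p(1) by (auto simp: dist_real_def)
    moreover have "continuous_on {r..t} p" by (rule continuous_on_subset[OF contp]) auto
    ultimately show ?thesis
      unfolding U_def using t(1) integral_less_real[of r t "\<lambda>_. 0" p] by simp
  qed
  have near: "u x > U r" if "x \<in> A" "norm x < r + \<delta>" for x
    using pos[of "norm x"] that by (simp add: u_def Ur A_def shell_iff)
  have fails: "\<not> (\<forall>x\<in>A. U R < u x \<and> u x < U r)"
  proof -
    define t where "t = r + min (\<delta> / 2) ((R - r) / 2)"
    have t: "r < t" "t < R" "t < r + \<delta>" using \<delta>(1) R(1) by (auto simp: t_def min_def field_simps)
    obtain x :: "real ^ 'n" where "norm x = t" using vector_choose_size[of t] t assms(2) by auto
    with t near[of x] show ?thesis by (force simp: A_def shell_iff)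
  qed

  have solution: "\<exists>Du \<nu> H. C1_closure_C2 A u Du \<and>
      (\<forall>x\<in>A. \<exists>d. has_divergence (\<lambda>y. Du y /\<^sub>R sqrt (1 + (norm (Du y))\<^sup>2)) x d \<and>
         - d = 1 / sqrt (1 + (norm (Du x))\<^sup>2)) \<and>
      (\<forall>x\<in>sphere 0 R. u x = U R) \<and> (\<forall>x\<in>sphere 0 r. u x = U r) \<and>
      is_outer_unit_normal A \<nu> \<and> is_mean_curvature A \<nu> H \<and>
      (\<exists>\<Gamma>>0. \<exists>C. \<forall>x\<in>frontier A. Du x \<bullet> \<nu> x = \<Gamma> * H x + C)"
  proof (rule exI[of _ Du], rule exI[of _ \<nu>], rule exI[of _ H], intro conjI)
    show "C1_closure_C2 A u Du" by (rule regular)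
    show "\<forall>x\<in>A. \<exists>d. has_divergence (\<lambda>y. Du y /\<^sub>R sqrt (1 + (norm (Du y))\<^sup>2)) x d \<and>
        - d = 1 / sqrt (1 + (norm (Du x))\<^sup>2)"
    proof
      fix x assume "x \<in> A"
      show "\<exists>d. has_divergence (\<lambda>y. Du y /\<^sub>R sqrt (1 + (norm (Du y))\<^sup>2)) x d \<and>
          - d = 1 / sqrt (1 + (norm (Du x))\<^sup>2)"
        by (rule exI, rule conjI, rule pde[OF \<open>x \<in> A\<close>]) simp
    qed
    show "is_outer_unit_normal A \<nu>"
      unfolding A_def \<nu>_def by (rule shell_outer_unit_normal[OF assms(2) R(1)])
    show "is_mean_curvature A \<nu> H"
      unfolding A_def \<nu>_def H_def by (rule shell_mean_curvature[OF assms(2) R(1) assms(1)])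
    show "\<exists>\<Gamma>>0. \<exists>C. \<forall>x\<in>frontier A. Du x \<bullet> \<nu> x = \<Gamma> * H x + C"
      using \<open>\<Gamma> > 0\<close> law by blast
  qed (auto simp: u_def)
  have near_inner: "\<exists>\<delta>>0. \<forall>x\<in>A. norm x < r + \<delta> \<longrightarrow> u x > U r"
    using \<delta>(1) near by blast
  note shell_claims =
    conjI[OF Ur conjI[OF neg[folded U_def] conjI[OF solution conjI[OF near_inner fails]]]]
  show ?thesis
  proof (rule exI[of _ p], intro conjI)
    show "solves_profile_ode CARD('n) r \<alpha> p" using p(1,2) by (simp add: ode_iff)
    show "\<forall>q. solves_profile_ode CARD('n) r \<alpha> q \<longrightarrow> (\<forall>\<rho>\<ge>r. q \<rho> = p \<rho>)"
      using unique by blast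
  qed (rule exI[of _ R], unfold Let_def, rule conjI[OF R(1)], rule shell_claims[unfolded u_def U_def A_def])
qed

end
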